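(* For $n\ge1$ let $U_n$ be uniformly distributed on $\{1,2,\dots,n\}$. For $\alpha>1$ let $d_\alpha$ have the delta-Zeta distribution $\delta\zeta(\alpha)$, with $d_\alpha$ independent of $(U_n)_n$, and let $Z_\alpha$ have the Zeta distribution $\zeta(\alpha)$. Let $U_{d_\alpha}$ denote the independent randomisation, i.e. $\mathbb P(U_{d_\alpha}=k)=\sum_{n\ge1}\mathbb P(U_n=k)\,\mathbb P(d_\alpha=n)$ for $k\geq 1$. Then: (1) $U_{d_\alpha}$ and $Z_\alpha$ have the same distribution. (2) This equality in law determines uniquely the laws of $(d_\alpha,Z_\alpha)$ in the following sense: let $X$ be a random variable with values in $\mathbb N^*=\{1,2,\dots\}$ independent of $(U_n)_n$, and let $Y$ be a random variable with values in $\mathbb N^*$ having the same distribution as $U_X$, such that the $p$-adic valuations $(v_p(Y))_{p\text{ prime}}$ are independent and each $v_p(Y)$ has a geometric distribution (of some parameter $w_p\in(0,1)$). Then there exists a unique $\alpha>1$ such that $X\sim\delta\zeta(\alpha)$ and $Y\sim\zeta(\alpha)$.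
   Context: The Zeta distribution $\zeta(\alpha)$, $\alpha>1$, is the law on $\mathbb N^*$ with $\mathbb P(Z_\alpha=k)=\frac{1}{\zeta(\alpha)k^\alpha}$, where $\zeta(\alpha)=\sum_{n\ge1}n^{-\alpha}$. The delta-Zeta distribution $\delta\zeta(\alpha)$, $\alpha>1$, is the law on $\mathbb N^*$ with $$\mathbb P(d_\alpha=k)=\frac{k}{\zeta(\alpha)}\Big(\frac1{k^\alpha}-\frac1{(k+1)^\alpha}\Big),\qquad k\ge1.$$ For $k\ge 1$, $v_p(k)$ is the exponent of the prime $p$ in the prime factorisation of $k$. The geometric distribution of parameter $t\in(0,1)$ is the law on $\{0,1,2,\dots\}$ with $\mathbb P(G=k)=(1-t)t^k$. *)

theory Defs
  imports "HOL-Probability.Probability" "HOL-Real_Asymp.Real_Asymp"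
    "HOL-Computational_Algebra.Primes"
begin

definition zeta_real :: "real \<Rightarrow> real" where
  "zeta_real \<alpha> = (\<Sum>n. 1 / real (Suc n) powr \<alpha>)"

text \<open>
  The positive integers are represented inside \<^typ>\<open>nat\<close>: a law on them is a law on
  \<^typ>\<open>nat\<close> giving mass zero to \<open>0\<close>.  The two point mass functions below are laws only for
  \<open>\<alpha> > 1\<close>; see \<open>pmf_zeta_pmf\<close> and \<open>pmf_delta_zeta_pmf\<close>.
\<close>

definition zeta_pmf :: "real \<Rightarrow> nat pmf" where
  "zeta_pmf \<alpha> = embed_pmf (\<lambda>k. if k = 0 then 0 else 1 / (zeta_real \<alpha> * real k powr \<alpha>))"

definition delta_zeta_pmf :: "real \<Rightarrow> nat pmf" where
  "delta_zeta_pmf \<alpha> = embed_pmf (\<lambda>k. if k = 0 then 0 else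
     real k / zeta_real \<alpha> * (1 / real k powr \<alpha> - 1 / real (k + 1) powr \<alpha>))"

definition has_law :: "'a measure \<Rightarrow> ('a \<Rightarrow> 'b) \<Rightarrow> 'b pmf \<Rightarrow> bool" where
  "has_law M X p \<longleftrightarrow> X \<in> measurable M (count_space UNIV) \<and>
     distr M (count_space UNIV) X = measure_pmf p"

text \<open>
  A sequence \<open>U\<^sub>1, U\<^sub>2, \<dots>\<close> with \<open>U\<^sub>n\<close> uniform on \<open>{1, \<dots>, n}\<close>; \<open>U\<^sub>0\<close> is irrelevant.  Nothing is
  assumed about the joint law of the \<open>U\<^sub>n\<close>.
\<close>

definition uniform_seq :: "'a measure \<Rightarrow> (nat \<Rightarrow> 'a \<Rightarrow> nat) \<Rightarrow> bool" where
  "uniform_seq M U \<longleftrightarrow> (\<forall>n\<ge>1. U n \<in> measurable M (count_space {1..}) \<and>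
     has_law M (U n) (pmf_of_set {1..n}))"

text \<open>
  Independence of a positive integer variable \<open>X\<close> from the whole sequence, regarded as one random
  element of a countable product.  The library's \<open>indep_var\<close> requires both variables to have
  the same value type, hence the formulation with the generated sigma-algebras.
\<close>

definition indep_of_seq :: "'a measure \<Rightarrow> ('a \<Rightarrow> nat) \<Rightarrow> (nat \<Rightarrow> 'a \<Rightarrow> nat) \<Rightarrow> bool" where
  "indep_of_seq M X U \<longleftrightarrow> X \<in> measurable M (count_space {1..}) \<and>
     prob_space.indep_set M
       {X -` A \<inter> space M | A. A \<in> sets (count_space {1..})}
       {(\<lambda>\<omega>. \<lambda>n\<in>{1..}. U n \<omega>) -` B \<inter> space M | B. B \<in> sets (\<Pi>\<^sub>M n\<in>{1..}. count_space {1..})}"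

text \<open>The variable \<open>U\<^sub>X\<close>; its law is computed in \<open>prob_randomised\<close>.\<close>

definition randomised :: "(nat \<Rightarrow> 'a \<Rightarrow> nat) \<Rightarrow> ('a \<Rightarrow> nat) \<Rightarrow> 'a \<Rightarrow> nat" where
  "randomised U X = (\<lambda>\<omega>. U (X \<omega>) \<omega>)"

text \<open>
  The library's \<open>geometric_pmf p\<close> gives mass \<open>(1 - p) ^ k * p\<close> to \<open>k\<close>, so that the geometric
  law of parameter \<open>t\<close> in the convention \<open>(1 - t) * t ^ k\<close> is \<open>geometric_pmf (1 - t)\<close>.
\<close>

definition geometric_law :: "real \<Rightarrow> nat pmf" where
  "geometric_law t = geometric_pmf (1 - t)"


lemma pmf_geometric_law: "0 < t \<Longrightarrow> t < 1 \<Longrightarrow> pmf (geometric_law t) k = (1 - t) * t ^ k"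
  by (simp add: geometric_law_def)

lemma zeta_real_sums:
  assumes "\<alpha> > 1"
  shows "(\<lambda>n. 1 / real (Suc n) powr \<alpha>) sums zeta_real \<alpha>"
proof -
  have "summable (\<lambda>n. real n powr (-\<alpha>))"
    using assms by (simp add: summable_real_powr_iff)
  hence "summable (\<lambda>n. 1 / real (Suc n) powr \<alpha>)"
    by (subst (asm) summable_Suc_iff [symmetric]) (simp add: powr_minus_divide)
  thus ?thesis by (simp add: zeta_real_def summable_sums)
qed

lemma zeta_real_pos:
  assumes "\<alpha> > 1"
  shows "zeta_real \<alpha> > 0"
  unfolding zeta_real_def
  by (rule suminf_pos) (use zeta_real_sums[OF assms] in \<open>auto simp: sums_iff\<close>)

lemma delta_zeta_sums:
  assumes "\<alpha> > 1"
  shows "(\<lambda>n. real (Suc n) * (1 / real (Suc n) powr \<alpha> - 1 / real (Suc n + 1) powr \<alpha>))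
           sums zeta_real \<alpha>"
proof -
  have eq: "(\<Sum>i<N. real (Suc i) * (1 / real (Suc i) powr \<alpha> - 1 / real (Suc i + 1) powr \<alpha>)) =
      (\<Sum>i<N. 1 / real (Suc i) powr \<alpha>) - real N * (1 / real (N + 1) powr \<alpha>)" for N
    by (induction N) (simp_all add: algebra_simps add_divide_distrib)
  have "(\<lambda>N. real N * (1 / real (N + 1) powr \<alpha>)) \<longlonglongrightarrow> 0"
    using assms by real_asymp
  with zeta_real_sums[OF assms] have
    "(\<lambda>N. (\<Sum>i<N. 1 / real (Suc i) powr \<alpha>) - real N * (1 / real (N + 1) powr \<alpha>))
       \<longlonglongrightarrow> zeta_real \<alpha> - 0"
    unfolding sums_def by (intro tendsto_diff)
  thus ?thesis unfolding sums_def eq by simp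
qed

lemma pmf_embed_pmf_pos:
  fixes f :: "nat \<Rightarrow> real"
  assumes "\<And>k. 0 \<le> f k" "f 0 = 0" "(\<lambda>n. f (Suc n)) sums 1"
  shows "pmf (embed_pmf f) k = f k"
proof (rule pmf_embed_pmf)
  have "f sums 1" using assms(2,3) sums_Suc_iff[of f 1] by simp
  hence "(\<Sum>i. ennreal (f i)) = ennreal 1"
    using assms(1) by (intro suminf_ennreal_eq) auto
  thus "(\<integral>\<^sup>+x. ennreal (f x) \<partial>count_space UNIV) = 1"
    by (simp add: nn_integral_count_space_nat)
qed (use assms in auto)

lemma pmf_zeta_pmf:
  assumes "\<alpha> > 1"
  shows "pmf (zeta_pmf \<alpha>) k = (if k = 0 then 0 else 1 / (zeta_real \<alpha> * real k powr \<alpha>))"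
  unfolding zeta_pmf_def
proof (rule pmf_embed_pmf_pos)
  show "(\<lambda>n. if Suc n = 0 then 0 else 1 / (zeta_real \<alpha> * real (Suc n) powr \<alpha>)) sums 1"
    using sums_divide[OF zeta_real_sums[OF assms], of "zeta_real \<alpha>"] zeta_real_pos[OF assms]
    by (simp add: mult.commute)
qed (use zeta_real_pos[OF assms] in auto)

lemma pmf_delta_zeta_pmf:
  assumes "\<alpha> > 1"
  shows "pmf (delta_zeta_pmf \<alpha>) k = (if k = 0 then 0 else
     real k / zeta_real \<alpha> * (1 / real k powr \<alpha> - 1 / real (k + 1) powr \<alpha>))"
  unfolding delta_zeta_pmf_def
proof (rule pmf_embed_pmf_pos)
  show "(\<lambda>n. if Suc n = 0 then 0 else real (Suc n) / zeta_real \<alpha> *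
          (1 / real (Suc n) powr \<alpha> - 1 / real (Suc n + 1) powr \<alpha>)) sums 1"
    using sums_divide[OF delta_zeta_sums[OF assms], of "zeta_real \<alpha>"] zeta_real_pos[OF assms]
    by simp
next
  fix k
  have "real k powr \<alpha> \<le> real (k + 1) powr \<alpha>"
    using assms by (intro powr_mono2) auto
  hence "1 / real (k + 1) powr \<alpha> \<le> 1 / real k powr \<alpha>" if "k \<noteq> 0"
    using that by (intro divide_left_mono) auto
  thus "0 \<le> (if k = 0 then 0 else
     real k / zeta_real \<alpha> * (1 / real k powr \<alpha> - 1 / real (k + 1) powr \<alpha>))"
    using zeta_real_pos[OF assms] by auto
qed auto

lemma prob_randomised:
  assumes "prob_space M" "uniform_seq M U" "indep_of_seq M X U"
  shows "randomised U X \<in> measurable M (count_space {1..})"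
    and "(\<lambda>n. measure M {\<omega>\<in>space M. U (Suc n) \<omega> = k} * measure M {\<omega>\<in>space M. X \<omega> = Suc n})
           sums measure M {\<omega>\<in>space M. randomised U X \<omega> = k}"
proof -
  interpret prob_space M by fact
  let ?P = "\<Pi>\<^sub>M n\<in>{1::nat..}. count_space {1::nat..}"
  have X: "X \<in> measurable M (count_space {1..})"
    using assms(3) unfolding indep_of_seq_def by blast
  have U: "U n \<in> measurable M (count_space {1..})" if "n \<ge> 1" for n
    using assms(2) that by (auto simp: uniform_seq_def)
  have Xpos: "X \<omega> \<ge> 1" if "\<omega> \<in> space M" for \<omega>
    using measurable_space[OF X that] by simp
  have Xset: "{\<omega>\<in>space M. X \<omega> = n} \<in> sets M" for n
  proof (cases "n \<ge> 1")
    case True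
    have "X -` {n} \<inter> space M \<in> sets M" using True by (intro measurable_sets[OF X]) auto
    thus ?thesis by (simp add: vimage_def Int_def conj_commute)
  next
    case False
    hence "{\<omega>\<in>space M. X \<omega> = n} = {}" using Xpos by force
    thus ?thesis by (simp only: sets.empty_sets)
  qed
  have Uset: "{\<omega>\<in>space M. U n \<omega> \<in> A} \<in> sets M" if "n \<ge> 1" for n A
  proof -
    have "U n -` (A \<inter> {1..}) \<inter> space M \<in> sets M" by (intro measurable_sets[OF U[OF that]]) auto
    also have "U n -` (A \<inter> {1..}) \<inter> space M = {\<omega>\<in>space M. U n \<omega> \<in> A}"
      using measurable_space[OF U[OF that]] by auto
    finally show ?thesis .
  qed
  have eq: "{\<omega>\<in>space M. randomised U X \<omega> \<in> A} =
      (\<Union>n. {\<omega>\<in>space M. U (Suc n) \<omega> \<in> A} \<inter> {\<omega>\<in>space M. X \<omega> = Suc n})" for A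
    using Xpos by (force simp: randomised_def Suc_le_eq gr0_conv_Suc)
  show "randomised U X \<in> measurable M (count_space {1..})"
  proof (rule measurableI)
    fix \<omega> assume "\<omega> \<in> space M"
    thus "randomised U X \<omega> \<in> space (count_space {1..})"
      using Xpos measurable_space[OF U] by (fastforce simp: randomised_def)
  next
    fix A
    have "{\<omega>\<in>space M. randomised U X \<omega> \<in> A} \<in> sets M"
      unfolding eq using Xset Uset by (intro sets.countable_UN sets.Int image_subsetI) auto
    thus "randomised U X -` A \<inter> space M \<in> sets M"
      by (simp add: vimage_def Int_def conj_commute)
  qed
  have ind: "measure M ({\<omega>\<in>space M. U (Suc n) \<omega> \<in> {k}} \<inter> {\<omega>\<in>space M. X \<omega> = Suc n}) =
     measure M {\<omega>\<in>space M. U (Suc n) \<omega> = k} * measure M {\<omega>\<in>space M. X \<omega> = Suc n}" for n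
  proof (cases "k \<ge> 1")
    case True
    let ?B = "{u \<in> space ?P. u (Suc n) \<in> {k}}"
    have B: "?B \<in> sets ?P"
    proof -
      have "(\<lambda>u. u (Suc n)) \<in> measurable ?P (count_space {1..})"
        by (rule measurable_component_singleton) auto
      from measurable_sets[OF this, of "{k}"] show ?thesis
        using True by (simp add: vimage_def Int_def conj_commute)
    qed
    have Usp: "(\<lambda>n\<in>{1..}. U n \<omega>) \<in> space ?P" if "\<omega> \<in> space M" for \<omega>
      using that measurable_space[OF U] by (auto simp: space_PiM)
    have "prob ((X -` {Suc n} \<inter> space M) \<inter> ((\<lambda>\<omega>. \<lambda>n\<in>{1..}. U n \<omega>) -` ?B \<inter> space M)) =
       prob (X -` {Suc n} \<inter> space M) * prob ((\<lambda>\<omega>. \<lambda>n\<in>{1..}. U n \<omega>) -` ?B \<inter> space M)"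
    proof (rule indep_setD)
      show "indep_set {X -` A \<inter> space M | A. A \<in> sets (count_space {1..})}
        {(\<lambda>\<omega>. \<lambda>n\<in>{1..}. U n \<omega>) -` B \<inter> space M | B. B \<in> sets ?P}"
        using assms(3) by (simp only: indep_of_seq_def)
      have "{Suc n} \<in> sets (count_space {1..})" by simp
      thus "X -` {Suc n} \<inter> space M \<in> {X -` A \<inter> space M | A. A \<in> sets (count_space {1..})}"
        by blast
      show "(\<lambda>\<omega>. \<lambda>n\<in>{1..}. U n \<omega>) -` ?B \<inter> space M \<in>
        {(\<lambda>\<omega>. \<lambda>n\<in>{1..}. U n \<omega>) -` B \<inter> space M | B. B \<in> sets ?P}"
        using B by blast
    qed
    moreover have "(X -` {Suc n} \<inter> space M) \<inter> ((\<lambda>\<omega>. \<lambda>n\<in>{1..}. U n \<omega>) -` ?B \<inter> space M) =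
       {\<omega>\<in>space M. U (Suc n) \<omega> \<in> {k}} \<inter> {\<omega>\<in>space M. X \<omega> = Suc n}"
      using Usp by auto
    moreover have "(\<lambda>\<omega>. \<lambda>n\<in>{1..}. U n \<omega>) -` ?B \<inter> space M = {\<omega>\<in>space M. U (Suc n) \<omega> = k}"
      using Usp by auto
    moreover have "X -` {Suc n} \<inter> space M = {\<omega>\<in>space M. X \<omega> = Suc n}" by auto
    ultimately show ?thesis by (simp add: mult.commute)
  next
    case False
    hence "{\<omega>\<in>space M. U (Suc n) \<omega> = k} = {}"
      using measurable_space[OF U[of "Suc n"]] by force
    thus ?thesis by (simp only: singleton_iff Int_empty_left measure_empty mult_zero_left)
  qed
  have "(\<lambda>n. prob ({\<omega>\<in>space M. U (Suc n) \<omega> \<in> {k}} \<inter> {\<omega>\<in>space M. X \<omega> = Suc n})) sums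
      prob (\<Union>n. {\<omega>\<in>space M. U (Suc n) \<omega> \<in> {k}} \<inter> {\<omega>\<in>space M. X \<omega> = Suc n})"
  proof (rule finite_measure_UNION)
    show "range (\<lambda>n. {\<omega>\<in>space M. U (Suc n) \<omega> \<in> {k}} \<inter> {\<omega>\<in>space M. X \<omega> = Suc n}) \<subseteq> events"
      by (intro image_subsetI sets.Int Xset Uset) simp
  qed (auto simp: disjoint_family_on_def)
  thus "(\<lambda>n. measure M {\<omega>\<in>space M. U (Suc n) \<omega> = k} * measure M {\<omega>\<in>space M. X \<omega> = Suc n})
           sums measure M {\<omega>\<in>space M. randomised U X \<omega> = k}"
    unfolding ind eq[of "{k}", symmetric] by simp
qed

end

theory Submission
  imports Defs
begin

text \<open>
  Write \<open>x k\<close> for the probability that \<open>X = k\<close> and \<open>y k\<close> for the probability that \<open>U\<^sub>X = k\<close>.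
  Conditioning on \<open>X\<close> gives \<open>y k = (\<Sum>n\<ge>k. x n / n)\<close>.  For the delta-Zeta law, \<open>x n / n\<close> is the
  decrement of \<open>n powr (-\<alpha>) / \<zeta>(\<alpha>)\<close>, the series telescopes, and \<open>U\<^sub>X\<close> has the Zeta law.

  The converse rests on two features of the law \<open>y\<close> of \<open>Y\<close>.  Subtracting consecutive sums
  gives \<open>x k = k * (y k - y (k + 1))\<close> (\<open>randomised_difference\<close>); hence \<open>y\<close> is nonincreasing on the positive integers, and it
  determines \<open>x\<close>.  On the other hand the valuations of \<open>Y\<close> are independent and geometric, so
  \<open>y k\<close> is the infinite product of \<open>(1 - w\<^sub>p) * w\<^sub>p ^ v\<^sub>p(k)\<close> over the primes, and the additivity of
  \<open>v\<^sub>p\<close> makes \<open>y k / y 1\<close> completely multiplicative (\<open>valuations_multiplicative\<close>).  A positive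
  nonincreasing completely multiplicative function is a power \<open>k powr (-\<alpha>)\<close>
  (\<open>antimono_completely_multiplicative_imp_power\<close>).  Since \<open>y\<close> is summable with sum 1, necessarily
  \<open>\<alpha> > 1\<close> and \<open>y 1 = 1 / \<zeta>(\<alpha>)\<close>; so \<open>Y\<close> has the Zeta law, and the difference formula turns this
  into the delta-Zeta law for \<open>X\<close>.  The exponent is unique, because the ratio of the masses at 1
  and 2 is \<open>2 powr \<alpha>\<close>.
\<close>

section \<open>Laws on the natural numbers\<close>

lemma has_law_nat_iff:
  fixes X :: "'a \<Rightarrow> nat"
  assumes "prob_space M" and X: "X \<in> measurable M (count_space UNIV)"
  shows "has_law M X p \<longleftrightarrow> (\<forall>k. measure M {\<omega>\<in>space M. X \<omega> = k} = pmf p k)"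
proof -
  interpret prob_space M by fact
  have point: "measure (distr M (count_space UNIV) X) {k} = measure M {\<omega>\<in>space M. X \<omega> = k}" for k
  proof -
    have "X -` {k} \<inter> space M = {\<omega>\<in>space M. X \<omega> = k}" by auto
    thus ?thesis by (simp add: measure_distr[OF X])
  qed
  show ?thesis
  proof
    assume "has_law M X p"
    thus "\<forall>k. measure M {\<omega>\<in>space M. X \<omega> = k} = pmf p k"
      by (simp add: has_law_def flip: point measure_pmf_single)
  next
    assume eq: "\<forall>k. measure M {\<omega>\<in>space M. X \<omega> = k} = pmf p k"
    interpret D: prob_space "distr M (count_space UNIV) X" by (rule prob_space_distr) (rule X)
    have "distr M (count_space UNIV) X = measure_pmf p"
    proof (rule measure_eqI_countable[where A = UNIV])
      show "emeasure (distr M (count_space UNIV) X) {k} = emeasure (measure_pmf p) {k}" for k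
        by (simp add: D.emeasure_eq_measure measure_pmf.emeasure_eq_measure measure_pmf_single
            point eq)
    qed auto
    thus "has_law M X p" using X by (simp add: has_law_def)
  qed
qed

lemma has_law_nat_prob:
  fixes X :: "'a \<Rightarrow> nat"
  assumes "prob_space M" "has_law M X p"
  shows "measure M {\<omega>\<in>space M. X \<omega> = k} = pmf p k"
proof -
  have "X \<in> measurable M (count_space UNIV)" using assms(2) by (simp add: has_law_def)
  from has_law_nat_iff[OF assms(1) this] assms(2) show ?thesis by blast
qed

lemma measurable_pos_imp_measurable_nat:
  fixes X :: "'a \<Rightarrow> nat"
  assumes "X \<in> measurable M (count_space {1..})"
  shows "X \<in> measurable M (count_space UNIV)"
proof -
  have "(\<lambda>k. k) \<in> measurable (count_space {1::nat..}) (count_space UNIV)"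
    by simp
  from measurable_compose[OF assms this] show ?thesis .
qed

lemma prob_pos_valued_zero:
  fixes X :: "'a \<Rightarrow> nat"
  assumes "X \<in> measurable M (count_space {1..})"
  shows "measure M {\<omega>\<in>space M. X \<omega> = 0} = 0"
proof -
  have "{\<omega>\<in>space M. X \<omega> = 0} = {}"
    using measurable_space[OF assms] by force
  thus ?thesis by (simp only: measure_empty)
qed

section \<open>Randomising the uniform sequence\<close>

lemma randomised_sums:
  assumes "prob_space M" "uniform_seq M U" "indep_of_seq M X U" and "k \<ge> 1"
  shows "(\<lambda>n. if k \<le> Suc n then measure M {\<omega>\<in>space M. X \<omega> = Suc n} / real (Suc n) else 0)
           sums measure M {\<omega>\<in>space M. randomised U X \<omega> = k}"
proof -
  have "measure M {\<omega>\<in>space M. U (Suc n) \<omega> = k} = (if k \<le> Suc n then 1 / real (Suc n) else 0)" for n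
  proof -
    have U: "has_law M (U (Suc n)) (pmf_of_set {1..Suc n})"
      using assms(2) by (simp add: uniform_seq_def)
    hence "measure M {\<omega>\<in>space M. U (Suc n) \<omega> = k} = pmf (pmf_of_set {1..Suc n}) k"
      by (rule has_law_nat_prob[OF assms(1)])
    also have "\<dots> = indicator {1..Suc n} k / real (card {1..Suc n})"
      by (rule pmf_of_set) auto
    finally show ?thesis using assms(4) by (simp add: indicator_def)
  qed
  hence "(\<lambda>n. measure M {\<omega>\<in>space M. U (Suc n) \<omega> = k} * measure M {\<omega>\<in>space M. X \<omega> = Suc n}) =
      (\<lambda>n. if k \<le> Suc n then measure M {\<omega>\<in>space M. X \<omega> = Suc n} / real (Suc n) else 0)"
    by (intro ext) simp
  with prob_randomised(2)[OF assms(1-3), of k] show ?thesis by simp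
qed

text \<open>
  The series for \<open>U\<^sub>X = k\<close> and \<open>U\<^sub>X = k + 1\<close> differ only in the term in which \<open>X = k\<close>.  This
  inverts the passage from the law of \<open>X\<close> to the law of \<open>U\<^sub>X\<close> and shows that the latter has
  nonincreasing point masses on the positive integers.
\<close>

lemma randomised_difference:
  assumes "prob_space M" "uniform_seq M U" "indep_of_seq M X U" and "k \<ge> 1"
  shows "measure M {\<omega>\<in>space M. X \<omega> = k} = real k *
      (measure M {\<omega>\<in>space M. randomised U X \<omega> = k} -
       measure M {\<omega>\<in>space M. randomised U X \<omega> = k + 1})"
proof -
  let ?x = "\<lambda>n. measure M {\<omega>\<in>space M. X \<omega> = n}"
  let ?y = "\<lambda>n. measure M {\<omega>\<in>space M. randomised U X \<omega> = n}"
  have "(\<lambda>n. (if k \<le> Suc n then ?x (Suc n) / real (Suc n) else 0) -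
          (if k + 1 \<le> Suc n then ?x (Suc n) / real (Suc n) else 0)) sums (?y k - ?y (k + 1))"
    using assms(4) by (intro sums_diff randomised_sums assms(1-3)) auto
  also have "(\<lambda>n. (if k \<le> Suc n then ?x (Suc n) / real (Suc n) else 0) -
          (if k + 1 \<le> Suc n then ?x (Suc n) / real (Suc n) else 0)) =
      (\<lambda>n. if n = k - 1 then ?x (Suc n) / real (Suc n) else 0)"
    using assms(4) by (intro ext) auto
  finally have "?y k - ?y (k + 1) = ?x (Suc (k - 1)) / real (Suc (k - 1))"
    by (rule sums_unique2[OF _ sums_single])
  thus ?thesis using assms(4) by (simp add: field_simps)
qed

lemma randomised_delta_zeta_law:
  assumes "prob_space M" "uniform_seq M U" "indep_of_seq M d U"
    and "\<alpha> > 1" and d: "has_law M d (delta_zeta_pmf \<alpha>)"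
  shows "has_law M (randomised U d) (zeta_pmf \<alpha>)"
proof -
  note meas = prob_randomised(1)[OF assms(1-3)]
  have "measure M {\<omega>\<in>space M. randomised U d \<omega> = k} = pmf (zeta_pmf \<alpha>) k" for k
  proof (cases "k = 0")
    case True
    thus ?thesis using prob_pos_valued_zero[OF meas] by (simp add: pmf_zeta_pmf assms(4))
  next
    case False
    define c where "c n = 1 / (zeta_real \<alpha> * real n powr \<alpha>)" for n :: nat
    have law: "measure M {\<omega>\<in>space M. d \<omega> = n} = pmf (delta_zeta_pmf \<alpha>) n" for n
      by (rule has_law_nat_prob[OF assms(1) d])
    have step: "measure M {\<omega>\<in>space M. d \<omega> = Suc n} / real (Suc n) = c (Suc n) - c (Suc (Suc n))" for n
      unfolding law pmf_delta_zeta_pmf[OF assms(4)] c_def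
      using zeta_real_pos[OF assms(4)] by (simp add: field_simps del: of_nat_Suc)
    \<comment> \<open>Holding \<open>c\<close> constant up to the index \<open>k\<close> makes the truncated series telescope as a whole.\<close>
    define h where "h n = c (max k (Suc n))" for n
    have "(\<lambda>n. if k \<le> Suc n then measure M {\<omega>\<in>space M. d \<omega> = Suc n} / real (Suc n) else 0) =
        (\<lambda>n. h n - h (Suc n))"
      unfolding step h_def by (intro ext) (auto simp: max_def not_le le_Suc_eq)
    moreover have "h \<longlonglongrightarrow> 0"
    proof -
      have "(\<lambda>n. c (Suc n)) \<longlonglongrightarrow> 0"
        unfolding c_def using assms(4) zeta_real_pos[OF assms(4)] by real_asymp
      moreover have "eventually (\<lambda>n. c (Suc n) = h n) sequentially"
        using eventually_ge_at_top[of k] by eventually_elim (simp add: h_def max_def)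
      ultimately show ?thesis by (rule Lim_transform_eventually)
    qed
    hence "(\<lambda>n. h n - h (Suc n)) sums (h 0 - 0)" by (rule telescope_sums')
    ultimately have "(\<lambda>n. if k \<le> Suc n then measure M {\<omega>\<in>space M. d \<omega> = Suc n} / real (Suc n) else 0)
        sums h 0" by simp
    moreover have "h 0 = c k" using False by (simp add: h_def max_absorb1)
    ultimately have "measure M {\<omega>\<in>space M. randomised U d \<omega> = k} = c k"
      using sums_unique2[OF randomised_sums[OF assms(1-3), of k]] False by simp
    thus ?thesis using False by (simp add: pmf_zeta_pmf[OF assms(4)] c_def)
  qed
  thus ?thesis
    using has_law_nat_iff[OF assms(1) measurable_pos_imp_measurable_nat[OF meas]] by blast
qed

section \<open>Independent geometric valuations\<close>

text \<open>
  A positive integer is determined by its valuations, so the event \<open>Y = k\<close> is the decreasing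
  intersection of the events that \<open>Y\<close> and \<open>k\<close> have the same valuations at all primes up to a bound.
  Independence for finitely many primes and continuity from above give the limit.  The bound
  starts at 2 so that the set of primes is never empty, as independence is stated for
  nonempty finite families.
\<close>

lemma prob_eq_limit_valuations:
  fixes Y :: "'b \<Rightarrow> nat" and w :: "nat \<Rightarrow> real"
  assumes "prob_space N" and Y: "Y \<in> measurable N (count_space {1..})"
    and indep: "prob_space.indep_vars N (\<lambda>_. count_space UNIV) (\<lambda>p \<omega>. multiplicity p (Y \<omega>))
          {p :: nat. prime p}"
    and w: "\<And>p. prime p \<Longrightarrow> 0 < w p \<and> w p < 1 \<and>
          has_law N (\<lambda>\<omega>. multiplicity p (Y \<omega>)) (geometric_law (w p))"
    and "k \<ge> 1"
  shows "(\<lambda>n. \<Prod>p | prime p \<and> p \<le> n + 2. (1 - w p) * w p ^ multiplicity p k)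
           \<longlonglongrightarrow> measure N {\<omega>\<in>space N. Y \<omega> = k}"
proof -
  interpret prob_space N by fact
  define J where "J n = {p :: nat. prime p \<and> p \<le> n + 2}" for n
  define E where "E n = (\<Inter>p\<in>J n. (\<lambda>\<omega>. multiplicity p (Y \<omega>)) -` {multiplicity p k} \<inter> space N)" for n
  have J: "finite (J n)" "2 \<in> J n" "J n \<subseteq> {p. prime p}" for n
    by (auto simp: J_def two_is_prime_nat)
  have ne: "J n \<noteq> {}" for n using J(2)[of n] by blast
  have E_eq: "E n = {\<omega>\<in>space N. \<forall>p\<in>J n. multiplicity p (Y \<omega>) = multiplicity p k}" for n
    using ne[of n] by (auto simp: E_def)
  have val: "(\<lambda>\<omega>. multiplicity p (Y \<omega>)) \<in> measurable N (count_space UNIV)" for p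
    by (rule measurable_compose[OF measurable_pos_imp_measurable_nat[OF Y]]) simp
  have "prob (E n) = (\<Prod>p\<in>J n. (1 - w p) * w p ^ multiplicity p k)" for n
  proof -
    have "prob (E n) = (\<Prod>p\<in>J n. prob ((\<lambda>\<omega>. multiplicity p (Y \<omega>)) -` {multiplicity p k} \<inter> space N))"
      unfolding E_def using J[of n] by (intro indep_varsD[OF indep]) auto
    also have "\<dots> = (\<Prod>p\<in>J n. (1 - w p) * w p ^ multiplicity p k)"
    proof (rule prod.cong)
      fix p assume "p \<in> J n"
      hence p: "prime p" by (simp add: J_def)
      have "(\<lambda>\<omega>. multiplicity p (Y \<omega>)) -` {multiplicity p k} \<inter> space N =
          {\<omega>\<in>space N. multiplicity p (Y \<omega>) = multiplicity p k}" by auto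
      thus "prob ((\<lambda>\<omega>. multiplicity p (Y \<omega>)) -` {multiplicity p k} \<inter> space N) =
          (1 - w p) * w p ^ multiplicity p k"
        using w[OF p] has_law_nat_iff[OF assms(1) val] by (simp add: pmf_geometric_law)
    qed simp
    finally show ?thesis .
  qed
  moreover have "(\<lambda>n. prob (E n)) \<longlonglongrightarrow> prob (\<Inter>n. E n)"
  proof (rule finite_Lim_measure_decseq)
    show "range E \<subseteq> sets N"
      unfolding E_def using J(1) ne measurable_sets[OF val]
      by (intro image_subsetI sets.finite_INT) auto
    show "decseq E"
      by (intro decseq_SucI) (auto simp: E_eq J_def)
  qed
  moreover have "(\<Inter>n. E n) = {\<omega>\<in>space N. Y \<omega> = k}"
  proof (intro set_eqI iffI)
    fix \<omega> assume \<omega>: "\<omega> \<in> (\<Inter>n. E n)"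
    hence sp: "\<omega> \<in> space N" by (simp add: E_eq)
    have "multiplicity p (Y \<omega>) = multiplicity p k" if "prime p" for p
    proof -
      have "\<omega> \<in> E p" "p \<in> J p" using \<omega> that by (auto simp: J_def)
      thus ?thesis by (simp add: E_eq)
    qed
    moreover have "Y \<omega> > 0" using measurable_space[OF Y sp] by simp
    ultimately have "Y \<omega> = k" using assms(5) by (auto intro: multiplicity_eq_nat[of "Y \<omega>" k])
    thus "\<omega> \<in> {\<omega>\<in>space N. Y \<omega> = k}" using sp by simp
  next
    fix \<omega> assume "\<omega> \<in> {\<omega>\<in>space N. Y \<omega> = k}"
    thus "\<omega> \<in> (\<Inter>n. E n)" by (simp add: E_eq)
  qed
  ultimately show ?thesis by (simp add: J_def)
qed

text \<open>
  Already the finite products of \<open>prob_eq_limit_valuations\<close> satisfy this identity, as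
  valuations are additive; it then passes to the limit.  Here \<open>y 1\<close> is the infinite product of
  the factors \<open>1 - w\<^sub>p\<close>, which might vanish a priori; hence the identity is free of quotients.
\<close>

lemma valuations_multiplicative:
  fixes Y :: "'b \<Rightarrow> nat" and w :: "nat \<Rightarrow> real"
  assumes "prob_space N" and "Y \<in> measurable N (count_space {1..})"
    and "prob_space.indep_vars N (\<lambda>_. count_space UNIV) (\<lambda>p \<omega>. multiplicity p (Y \<omega>))
          {p :: nat. prime p}"
    and "\<And>p. prime p \<Longrightarrow> 0 < w p \<and> w p < 1 \<and>
          has_law N (\<lambda>\<omega>. multiplicity p (Y \<omega>)) (geometric_law (w p))"
    and "m \<ge> 1" "n \<ge> 1"
  defines "y \<equiv> \<lambda>k. measure N {\<omega>\<in>space N. Y \<omega> = k}"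
  shows "y (m * n) * y 1 = y m * y n"
proof (rule LIMSEQ_unique)
  define P where "P k i = (\<Prod>p | prime p \<and> p \<le> i + 2. (1 - w p) * w p ^ multiplicity p k)"
    for k i :: nat
  have lim: "P k \<longlonglongrightarrow> y k" if "k \<ge> 1" for k
    unfolding P_def y_def by (rule prob_eq_limit_valuations[OF assms(1-4) that])
  have "P (m * n) i * P 1 i = P m i * P n i" for i
    unfolding P_def prod.distrib[symmetric] using assms(5,6)
    by (intro prod.cong) (auto simp: prime_elem_multiplicity_mult_distrib power_add)
  thus "(\<lambda>i. P m i * P n i) \<longlonglongrightarrow> y (m * n) * y 1"
    using tendsto_mult[OF lim lim, of "m * n" 1] assms(5,6) by simp
  show "(\<lambda>i. P m i * P n i) \<longlonglongrightarrow> y m * y n"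
    using assms(5,6) by (intro tendsto_mult lim)
qed

section \<open>Monotone completely multiplicative functions\<close>

text \<open>
  Powers of \<open>m\<close> and \<open>n\<close> can be compared as finely as wanted: from \<open>m ^ j \<le> n ^ i\<close>, where \<open>i\<close>
  is the least exponent that allows this, monotonicity gives \<open>j * h m \<le> i * h n\<close>.  As \<open>j\<close> grows,
  \<open>i / j\<close> tends to \<open>ln m / ln n\<close>.  Exchanging \<open>m\<close> and \<open>n\<close> yields equality, so \<open>h\<close> is a multiple
  of the logarithm.
\<close>

lemma monotone_additive_comparison:
  fixes h :: "nat \<Rightarrow> real"
  assumes add: "\<And>m n. m \<ge> 1 \<Longrightarrow> n \<ge> 1 \<Longrightarrow> h (m * n) = h m + h n"
    and mono: "\<And>m n. 1 \<le> m \<Longrightarrow> m \<le> n \<Longrightarrow> h m \<le> h n"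
    and "m \<ge> 2" "n \<ge> 2"
  shows "h m * ln (real n) \<le> h n * ln (real m)"
proof -
  have one: "h 1 = 0" using add[of 1 1] by simp
  have pow: "h (k ^ j) = real j * h k" if "k \<ge> 1" for k j
    using that one by (induction j) (simp_all add: add algebra_simps)
  have hn: "h n \<ge> 0" using mono[of 1 n] one assms(4) by simp
  define L where "L = ln (real m) / ln (real n)"
  have ln: "ln (real m) > 0" "ln (real n) > 0" using assms(3,4) by auto
  have "h m \<le> (L + 1 / real (Suc j)) * h n" for j
  proof -
    \<comment> \<open>the least \<open>i\<close> with \<open>m ^ Suc j \<le> n ^ i\<close>\<close>
    define i where "i = nat \<lceil>real (Suc j) * L\<rceil>"
    have L0: "real (Suc j) * L \<ge> 0" unfolding L_def using ln by (intro mult_nonneg_nonneg divide_nonneg_nonneg) auto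
    hence i: "real (Suc j) * L \<le> real i" "real i \<le> real (Suc j) * L + 1"
      unfolding i_def by linarith+
    have "ln (real (m ^ Suc j)) = real (Suc j) * ln (real m)"
      using assms(3) by (simp add: ln_realpow del: power_Suc)
    also have "\<dots> = (real (Suc j) * L) * ln (real n)" using ln by (simp add: L_def)
    also have "\<dots> \<le> real i * ln (real n)" using i ln by (intro mult_right_mono) auto
    also have "\<dots> = ln (real (n ^ i))" using assms(4) by (simp add: ln_realpow)
    finally have "real (m ^ Suc j) \<le> real (n ^ i)"
      using assms(3,4) by (subst (asm) ln_le_cancel_iff) auto
    hence "m ^ Suc j \<le> n ^ i" by (simp only: of_nat_le_iff)
    hence "h (m ^ Suc j) \<le> h (n ^ i)" using assms(3) by (intro mono) auto
    hence "real (Suc j) * h m \<le> real i * h n" using assms(3,4) by (simp add: pow del: power_Suc)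
    also have "\<dots> \<le> (real (Suc j) * L + 1) * h n" using i hn by (intro mult_right_mono)
    finally have "h m \<le> (real (Suc j) * L + 1) * h n / real (Suc j)"
      by (simp add: pos_le_divide_eq mult.commute del: of_nat_Suc)
    also have "\<dots> = (L + 1 / real (Suc j)) * h n" by (simp add: field_simps del: of_nat_Suc)
    finally show ?thesis .
  qed
  moreover have "(\<lambda>j. (L + 1 / real (Suc j)) * h n) \<longlonglongrightarrow> (L + 0) * h n"
    by (intro tendsto_intros LIMSEQ_Suc[OF lim_1_over_n])
  ultimately have "h m \<le> (L + 0) * h n"
    by (intro LIMSEQ_le_const) auto
  thus ?thesis using ln by (simp add: L_def field_simps)
qed

text \<open>
  The function \<open>- ln g\<close> is nondecreasing and turns products into sums, so by the comparison above
  it is a multiple of \<open>ln\<close>; the value at 2 fixes the factor.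
\<close>

lemma antimono_completely_multiplicative_imp_power:
  fixes g :: "nat \<Rightarrow> real"
  assumes pos: "\<And>n. n \<ge> 1 \<Longrightarrow> g n > 0"
    and mult: "\<And>m n. m \<ge> 1 \<Longrightarrow> n \<ge> 1 \<Longrightarrow> g (m * n) = g m * g n"
    and anti: "\<And>m n. 1 \<le> m \<Longrightarrow> m \<le> n \<Longrightarrow> g n \<le> g m"
  obtains \<alpha> where "\<And>n. n \<ge> 1 \<Longrightarrow> g n = real n powr (-\<alpha>)"
proof
  define h where "h n = - ln (g n)" for n
  fix n :: nat assume n: "n \<ge> 1"
  have g1: "g 1 = 1" using mult[of 1 1] pos[of 1] by simp
  have cmp: "h m * ln (real k) \<le> h k * ln (real m)" if "m \<ge> 2" "k \<ge> 2" for m k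
  proof (rule monotone_additive_comparison[OF _ _ that])
    show "h (i * j) = h i + h j" if "i \<ge> 1" "j \<ge> 1" for i j
      using pos[OF that(1)] pos[OF that(2)] by (simp add: h_def mult[OF that] ln_mult_pos)
    show "h i \<le> h j" if "1 \<le> i" "i \<le> j" for i j
      using pos[of i] pos[of j] anti[OF that] that by (simp add: h_def)
  qed
  show "g n = real n powr (- (h 2 / ln 2))"
  proof (cases "n = 1")
    case True
    thus ?thesis using g1 by simp
  next
    case False
    hence "h n * ln 2 = h 2 * ln (real n)" using cmp[of n 2] cmp[of 2 n] n by simp
    hence "h n = h 2 / ln 2 * ln (real n)" by (simp add: field_simps)
    moreover have "g n = exp (- h n)" using pos[OF n] by (simp add: h_def)
    ultimately show ?thesis using n by (simp add: powr_def)
  qed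
qed

section \<open>Characterisation of the Zeta law\<close>

lemma zeta_characterisation:
  fixes M :: "'a measure" and N :: "'b measure" and U :: "nat \<Rightarrow> 'a \<Rightarrow> nat"
    and X :: "'a \<Rightarrow> nat" and Y :: "'b \<Rightarrow> nat"
  assumes M: "prob_space M" and N: "prob_space N" and U: "uniform_seq M U"
    and ind: "indep_of_seq M X U" and Y: "Y \<in> measurable N (count_space {1..})"
    and law: "distr N (count_space UNIV) Y = distr M (count_space UNIV) (randomised U X)"
    and indep: "prob_space.indep_vars N (\<lambda>_. count_space UNIV) (\<lambda>p \<omega>. multiplicity p (Y \<omega>))
          {p :: nat. prime p}"
    and geom: "\<forall>p :: nat. prime p \<longrightarrow> (\<exists>w. 0 < w \<and> w < 1 \<and>
              has_law N (\<lambda>\<omega>. multiplicity p (Y \<omega>)) (geometric_law w))"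
  obtains \<alpha> where "\<alpha> > 1" "has_law M X (delta_zeta_pmf \<alpha>)" "has_law N Y (zeta_pmf \<alpha>)"
proof -
  interpret N: prob_space N by fact
  have X: "X \<in> measurable M (count_space {1..})" using ind by (simp add: indep_of_seq_def)
  note X' = measurable_pos_imp_measurable_nat[OF X]
  note Y' = measurable_pos_imp_measurable_nat[OF Y]
  note R' = measurable_pos_imp_measurable_nat[OF prob_randomised(1)[OF M U ind]]
  define x where "x k = measure M {\<omega>\<in>space M. X \<omega> = k}" for k
  define y where "y k = measure N {\<omega>\<in>space N. Y \<omega> = k}" for k
  have y: "y k = measure M {\<omega>\<in>space M. randomised U X \<omega> = k}" for k
  proof -
    have "Y -` {k} \<inter> space N = {\<omega>\<in>space N. Y \<omega> = k}"
      "randomised U X -` {k} \<inter> space M = {\<omega>\<in>space M. randomised U X \<omega> = k}" by auto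
    moreover have "measure (distr N (count_space UNIV) Y) {k} =
        measure (distr M (count_space UNIV) (randomised U X)) {k}" by (simp only: law)
    ultimately show ?thesis by (simp add: y_def measure_distr[OF Y'] measure_distr[OF R'])
  qed
  have diff: "x k = real k * (y k - y (k + 1))" if "k \<ge> 1" for k
    unfolding x_def y using that by (rule randomised_difference[OF M U ind])
  have y0: "y 0 = 0" unfolding y_def by (rule prob_pos_valued_zero[OF Y])
  have anti: "y n \<le> y m" if "1 \<le> m" "m \<le> n" for m n
    using that(2)
  proof (induction rule: dec_induct)
    case (step k)
    have "0 \<le> real k * (y k - y (k + 1))" 
      using diff[of k] step that(1) by (metis le_trans measure_nonneg x_def)
    hence "y (Suc k) \<le> y k" using step that(1) by (simp add: zero_le_mult_iff)
    thus ?case using step.IH by simp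
  qed simp
  obtain w where w: "\<And>p :: nat. prime p \<Longrightarrow> 0 < w p \<and> w p < 1 \<and>
      has_law N (\<lambda>\<omega>. multiplicity p (Y \<omega>)) (geometric_law (w p))"
    using geom by metis
  have mult: "y (m * n) * y 1 = y m * y n" if "m \<ge> 1" "n \<ge> 1" for m n
    unfolding y_def using that by (intro valuations_multiplicative[OF N Y indep w])
  have nonneg: "y k \<ge> 0" for k by (simp add: y_def)
  have total: "y sums 1"
  proof -
    have "(\<lambda>k. N.prob {\<omega>\<in>space N. Y \<omega> = k}) sums N.prob (\<Union>k. {\<omega>\<in>space N. Y \<omega> = k})"
    proof (rule N.finite_measure_UNION)
      have "{\<omega>\<in>space N. Y \<omega> = k} = Y -` {k} \<inter> space N" for k by auto
      thus "range (\<lambda>k. {\<omega>\<in>space N. Y \<omega> = k}) \<subseteq> sets N"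
        using measurable_sets[OF Y'] by auto
    qed (auto simp: disjoint_family_on_def)
    moreover have "(\<Union>k. {\<omega>\<in>space N. Y \<omega> = k}) = space N" by auto
    ultimately show ?thesis by (simp add: y_def[abs_def] N.prob_space)
  qed
  \<comment> \<open>\<open>y 1\<close> is the largest of the values \<open>y k\<close>, which sum up to 1.\<close>
  have y1: "y 1 > 0"
  proof (rule ccontr)
    assume "\<not> y 1 > 0"
    hence "y 1 = 0" using nonneg[of 1] by simp
    hence "y k = 0" for k using anti[of 1 k] nonneg[of k] y0 by (cases "k = 0") auto
    hence "y = (\<lambda>_. 0)" by auto
    thus False using total by (simp add: sums_iff)
  qed
  \<comment> \<open>If \<open>y\<close> vanished at 2, it would vanish beyond 2, so \<open>Y\<close> would be 1 almost surely, against
    \<open>w\<^sub>2 > 0\<close>.  Multiplicativity extends positivity to powers of 2, monotonicity to all numbers.\<close>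
  have ypos: "y k > 0" if "k \<ge> 1" for k
  proof -
    have y2: "y 2 > 0"
    proof (rule ccontr)
      assume "\<not> y 2 > 0"
      hence "y 2 = 0" using nonneg[of 2] by simp
      hence zero: "y k = 0" if "k \<noteq> 1" for k
        using anti[of 2 k] nonneg[of k] y0 that by (cases "k = 0") auto
      have "(\<lambda>k. if k = 1 then y k else 0) sums y 1" by (rule sums_single)
      moreover have "(\<lambda>k. if k = 1 then y k else 0) = y" using zero by auto
      ultimately have one: "y 1 = 1" using total sums_unique2 by metis
      have "(\<lambda>\<omega>. multiplicity 2 (Y \<omega>)) \<in> measurable N (count_space UNIV)"
        by (rule measurable_compose[OF Y']) simp
      hence eq: "measure N {\<omega>\<in>space N. multiplicity 2 (Y \<omega>) = 0} = 1 - w 2"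
        using w[of 2] has_law_nat_iff[OF N] by (simp add: pmf_geometric_law)
      have "y 1 \<le> measure N {\<omega>\<in>space N. multiplicity 2 (Y \<omega>) = 0}"
        unfolding y_def
      proof (rule N.finite_measure_mono)
        have "{\<omega>\<in>space N. multiplicity 2 (Y \<omega>) = 0} = (\<lambda>\<omega>. multiplicity 2 (Y \<omega>)) -` {0} \<inter> space N"
          by auto
        thus "{\<omega>\<in>space N. multiplicity 2 (Y \<omega>) = 0} \<in> sets N"
          using measurable_sets[OF measurable_compose[OF Y', of "multiplicity 2" "count_space UNIV"]]
          by simp
      qed auto
      thus False using eq one w[of 2] by simp
    qed
    have "y (2 ^ j) > 0" for j
    proof (induction j)
      case (Suc j)
      have "0 < y 2 * y (2 ^ j)" using Suc y2 by simp
      also have "\<dots> = y (2 ^ Suc j) * y 1" using mult[of 2 "2 ^ j"] by simp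
      finally show ?case using y1 by (simp add: zero_less_mult_iff)
    qed (use y1 in simp)
    from this[of k] show ?thesis
      using anti[OF that less_imp_le[OF less_exp]] by simp
  qed
  obtain \<alpha> where \<alpha>: "\<And>n. n \<ge> 1 \<Longrightarrow> y n / y 1 = real n powr (-\<alpha>)"
  proof (rule antimono_completely_multiplicative_imp_power[of "\<lambda>n. y n / y 1"])
    show "y (m * n) / y 1 = y m / y 1 * (y n / y 1)" if "m \<ge> 1" "n \<ge> 1" for m n
      using mult[OF that] y1 by (simp add: field_simps)
  qed (use ypos y1 anti in \<open>auto intro!: divide_right_mono simp: less_imp_le\<close>)
  have yk: "y n = y 1 * real n powr (-\<alpha>)" if "n \<ge> 1" for n
    using \<alpha>[OF that] y1 by (simp add: field_simps)
  have \<alpha>1: "\<alpha> > 1"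
  proof -
    have "summable (\<lambda>n. y n / y 1)" using total by (intro summable_divide) (simp add: sums_iff)
    moreover have "y n / y 1 = real n powr (-\<alpha>)" for n
      using \<alpha>[of n] y0 by (cases "n = 0") auto
    ultimately have "summable (\<lambda>n. real n powr (-\<alpha>))" by (simp only:)
    thus ?thesis by (simp add: summable_real_powr_iff)
  qed
  have y1_eq: "y 1 = 1 / zeta_real \<alpha>"
  proof -
    have "(\<lambda>n. y (Suc n)) sums 1" using total y0 by (simp add: sums_Suc_iff)
    moreover have "(\<lambda>n. y (Suc n)) sums (y 1 * zeta_real \<alpha>)"
      using sums_mult[OF zeta_real_sums[OF \<alpha>1], of "y 1"]
      by (subst yk) (simp_all add: powr_minus_divide)
    ultimately have "y 1 * zeta_real \<alpha> = 1" using sums_unique2 by metis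
    thus ?thesis using zeta_real_pos[OF \<alpha>1] by (simp add: field_simps)
  qed
  have y_eq: "y k = pmf (zeta_pmf \<alpha>) k" for k
    using yk[of k] y0 by (cases "k = 0") 
      (auto simp: pmf_zeta_pmf[OF \<alpha>1] y1_eq powr_minus_divide simp del: One_nat_def)
  have x_eq: "x k = pmf (delta_zeta_pmf \<alpha>) k" for k
  proof (cases "k = 0")
    case True
    thus ?thesis using prob_pos_valued_zero[OF X] by (simp add: x_def pmf_delta_zeta_pmf[OF \<alpha>1])
  next
    case False
    thus ?thesis using zeta_real_pos[OF \<alpha>1]
      by (simp add: diff y_eq pmf_zeta_pmf[OF \<alpha>1] pmf_delta_zeta_pmf[OF \<alpha>1] right_diff_distrib)
  qed
  show ?thesis
  proof
    show "has_law M X (delta_zeta_pmf \<alpha>)" using has_law_nat_iff[OF M X'] x_eq by (simp add: x_def)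
    show "has_law N Y (zeta_pmf \<alpha>)" using has_law_nat_iff[OF N Y'] y_eq by (simp add: y_def)
  qed (rule \<alpha>1)
qed

text \<open>
  The unknown normalising constant cancels in the ratio of two point masses.
\<close>

lemma zeta_pmf_inj:
  assumes "\<alpha> > 1" "\<beta> > 1" "zeta_pmf \<alpha> = zeta_pmf \<beta>"
  shows "\<alpha> = \<beta>"
proof -
  have ratio: "pmf (zeta_pmf \<gamma>) 1 / pmf (zeta_pmf \<gamma>) 2 = 2 powr \<gamma>" if "\<gamma> > 1" for \<gamma>
    using that zeta_real_pos[OF that] by (simp add: pmf_zeta_pmf)
  have "(2 :: real) powr \<alpha> = 2 powr \<beta>" using ratio[OF assms(1)] ratio[OF assms(2)] assms(3) by simp
  thus ?thesis by (simp add: powr_inj)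
qed

theorem theorem4p6:
  fixes M :: "'a measure" and N :: "'b measure" and U :: "nat \<Rightarrow> 'a \<Rightarrow> nat"
  assumes "prob_space M" and "prob_space N" and "uniform_seq M U"
  shows
    "(\<forall>\<alpha>>1. \<forall>(d :: 'a \<Rightarrow> nat) (Z :: 'b \<Rightarrow> nat).
        has_law M d (delta_zeta_pmf \<alpha>) \<longrightarrow> indep_of_seq M d U \<longrightarrow>
        has_law N Z (zeta_pmf \<alpha>) \<longrightarrow>
        distr M (count_space UNIV) (randomised U d) = distr N (count_space UNIV) Z) \<and>
     (\<forall>(X :: 'a \<Rightarrow> nat) (Y :: 'b \<Rightarrow> nat).
        X \<in> measurable M (count_space {1..}) \<longrightarrow> indep_of_seq M X U \<longrightarrow>
        Y \<in> measurable N (count_space {1..}) \<longrightarrow>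
        distr N (count_space UNIV) Y = distr M (count_space UNIV) (randomised U X) \<longrightarrow>
        prob_space.indep_vars N (\<lambda>_. count_space UNIV) (\<lambda>p \<omega>. multiplicity p (Y \<omega>))
          {p :: nat. prime p} \<longrightarrow>
        (\<forall>p :: nat. prime p \<longrightarrow>
           (\<exists>w. 0 < w \<and> w < 1 \<and>
              has_law N (\<lambda>\<omega>. multiplicity p (Y \<omega>)) (geometric_law w))) \<longrightarrow>
        (\<exists>!\<alpha>. \<alpha> > 1 \<and> has_law M X (delta_zeta_pmf \<alpha>) \<and> has_law N Y (zeta_pmf \<alpha>)))"
proof (intro conjI allI impI)
  fix \<alpha> :: real and d :: "'a \<Rightarrow> nat" and Z :: "'b \<Rightarrow> nat"
  assume "\<alpha> > 1" and d: "has_law M d (delta_zeta_pmf \<alpha>)" "indep_of_seq M d U"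
    and Z: "has_law N Z (zeta_pmf \<alpha>)"
  have "has_law M (randomised U d) (zeta_pmf \<alpha>)"
    by (rule randomised_delta_zeta_law) fact+
  thus "distr M (count_space UNIV) (randomised U d) = distr N (count_space UNIV) Z"
    using Z by (simp add: has_law_def)
next
  fix X :: "'a \<Rightarrow> nat" and Y :: "'b \<Rightarrow> nat"
  assume hyps: "indep_of_seq M X U" "Y \<in> measurable N (count_space {1..})"
    "distr N (count_space UNIV) Y = distr M (count_space UNIV) (randomised U X)"
    "prob_space.indep_vars N (\<lambda>_. count_space UNIV) (\<lambda>p \<omega>. multiplicity p (Y \<omega>))
       {p :: nat. prime p}"
    "\<forall>p :: nat. prime p \<longrightarrow> (\<exists>w. 0 < w \<and> w < 1 \<and>
       has_law N (\<lambda>\<omega>. multiplicity p (Y \<omega>)) (geometric_law w))"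
  obtain \<alpha> where \<alpha>: "\<alpha> > 1" "has_law M X (delta_zeta_pmf \<alpha>)" "has_law N Y (zeta_pmf \<alpha>)"
    by (rule zeta_characterisation[OF assms hyps])
  show "\<exists>!\<alpha>. \<alpha> > 1 \<and> has_law M X (delta_zeta_pmf \<alpha>) \<and> has_law N Y (zeta_pmf \<alpha>)"
  proof (intro ex1I conjI)
    fix \<beta> assume \<beta>: "\<beta> > 1 \<and> has_law M X (delta_zeta_pmf \<beta>) \<and> has_law N Y (zeta_pmf \<beta>)"
    have "measure_pmf (zeta_pmf \<beta>) = measure_pmf (zeta_pmf \<alpha>)"
      using \<alpha>(3) \<beta> by (simp add: has_law_def)
    hence "zeta_pmf \<beta> = zeta_pmf \<alpha>" by (simp add: measure_pmf_inject)
    thus "\<beta> = \<alpha>" using \<alpha>(1) \<beta> by (intro zeta_pmf_inj) auto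
  qed (rule \<alpha>)+
qed

end
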